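(* Let $(L,\vee,\wedge)$ be a distributive lattice and let $P$ be an integral operator on $L$. Define binary operations on $L$ by $$x\prec_P y:=x\wedge P(y),\qquad x\succ_P y:=P(x)\wedge y\quad\text{for all }x,y\in L.$$ Then $(L,\vee,\prec_P,\succ_P)$ is a dendriform semiring.
   Context: A map $P:L\to L$ on a lattice $(L,\vee,\wedge)$ is an integral operator if for all $x,y\in L$: (1) $P(x\vee y)=P(x)\vee P(y)$, and (2) $P(x)\wedge P(y)=P(P(x)\wedge y)\vee P(x\wedge P(y))$. A quadruple $(A,+,\prec,\succ)$ of a set with three binary operations is a dendriform semiring if $(A,+)$ is a semigroup, both $\prec$ and $\succ$ distribute over $+$ (on both sides), and for all $x,y,z\in A$: $$(x\prec y)\prec z=x\prec(y\prec z+y\succ z),$$ $$(x\succ y)\prec z=x\succ(y\prec z),$$ $$x\succ(y\succ z)=(x\prec y+x\succ y)\succ z.$$ *)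

theory Defs
  imports Main
begin

definition integral_operator :: "('a::lattice \<Rightarrow> 'a) \<Rightarrow> bool" where
  "integral_operator P \<longleftrightarrow>
     (\<forall>x y. P (sup x y) = sup (P x) (P y)) \<and>
     (\<forall>x y. inf (P x) (P y) = sup (P (inf (P x) y)) (P (inf x (P y))))"

text \<open>The underlying set is the whole type. As in the definition being formalized, the
  additive semigroup is not assumed to be commutative.\<close>

locale dendriform_semiring = add: semigroup add
  for add :: "'a \<Rightarrow> 'a \<Rightarrow> 'a" (infixl "\<oplus>" 65) +
  fixes dprec :: "'a \<Rightarrow> 'a \<Rightarrow> 'a" (infix "\<prec>" 70)
    and dsucc :: "'a \<Rightarrow> 'a \<Rightarrow> 'a" (infix "\<succ>" 70)
  assumes prec_distrib_left: "x \<prec> (y \<oplus> z) = (x \<prec> y) \<oplus> (x \<prec> z)"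
    and prec_distrib_right: "(x \<oplus> y) \<prec> z = (x \<prec> z) \<oplus> (y \<prec> z)"
    and succ_distrib_left: "x \<succ> (y \<oplus> z) = (x \<succ> y) \<oplus> (x \<succ> z)"
    and succ_distrib_right: "(x \<oplus> y) \<succ> z = (x \<succ> z) \<oplus> (y \<succ> z)"
    and prec_prec: "(x \<prec> y) \<prec> z = x \<prec> ((y \<prec> z) \<oplus> (y \<succ> z))"
    and succ_prec: "(x \<succ> y) \<prec> z = x \<succ> (y \<prec> z)"
    and succ_succ: "x \<succ> (y \<succ> z) = ((x \<prec> y) \<oplus> (x \<succ> y)) \<succ> z"

definition prec_op :: "('a::lattice \<Rightarrow> 'a) \<Rightarrow> 'a \<Rightarrow> 'a \<Rightarrow> 'a" where
  "prec_op P x y = inf x (P y)"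

definition succ_op :: "('a::lattice \<Rightarrow> 'a) \<Rightarrow> 'a \<Rightarrow> 'a \<Rightarrow> 'a" where
  "succ_op P x y = inf (P x) y"

end

theory Submission
  imports Defs
begin

text \<open>Put \<open>x \<star> y = sup (prec_op P x y) (succ_op P x y)\<close>. As \<open>P\<close> preserves joins, its two
  defining identities combine into \<open>P (x \<star> y) = inf (P x) (P y)\<close>. Each axiom relating
  two products then says that a meet of \<open>x\<close>, \<open>y\<close>, \<open>z\<close>, with \<open>P\<close> applied to two of the three, can be
  bracketed in two ways; the axioms in which \<open>\<star>\<close> occurs use this identity to split \<open>P\<close> of
  the sum into a meet. Distributivity of the lattice, together with join preservation,
  gives the distributive laws.\<close>

lemma integral_operator_sup:
  assumes "integral_operator P"
  shows "P (sup x y) = sup (P x) (P y)"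
  using assms by (simp add: integral_operator_def)

text \<open>The semiring analogue of the fact that a Rota--Baxter operator is multiplicative from
  the product it induces to the original product.\<close>

lemma integral_operator_sup_prec_succ:
  assumes "integral_operator P"
  shows "P (sup (prec_op P x y) (succ_op P x y)) = inf (P x) (P y)"
proof -
  have "inf (P x) (P y) = sup (P (succ_op P x y)) (P (prec_op P x y))"
    using assms by (simp add: integral_operator_def prec_op_def succ_op_def)
  then show ?thesis
    by (simp add: integral_operator_sup[OF assms] sup_commute)
qed

theorem proposition4p7:
  fixes P :: "'a::distrib_lattice \<Rightarrow> 'a"
  assumes "integral_operator P"
  shows "dendriform_semiring sup (prec_op P) (succ_op P)"
proof
  fix x y z :: 'a
  note P_sup = integral_operator_sup[OF assms]
  note P_star = integral_operator_sup_prec_succ[OF assms]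
  show "prec_op P x (sup y z) = sup (prec_op P x y) (prec_op P x z)"
    by (simp add: prec_op_def P_sup inf_sup_distrib1)
  show "prec_op P (sup x y) z = sup (prec_op P x z) (prec_op P y z)"
    by (simp add: prec_op_def inf_sup_distrib2)
  show "succ_op P x (sup y z) = sup (succ_op P x y) (succ_op P x z)"
    by (simp add: succ_op_def inf_sup_distrib1)
  show "succ_op P (sup x y) z = sup (succ_op P x z) (succ_op P y z)"
    by (simp add: succ_op_def P_sup inf_sup_distrib2)
  show "prec_op P (prec_op P x y) z = prec_op P x (sup (prec_op P y z) (succ_op P y z))"
    unfolding prec_op_def[of P x "sup _ _"] P_star
    by (simp add: prec_op_def inf_assoc)
  show "prec_op P (succ_op P x y) z = succ_op P x (prec_op P y z)"
    by (simp add: prec_op_def succ_op_def inf_assoc)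
  show "succ_op P x (succ_op P y z) = succ_op P (sup (prec_op P x y) (succ_op P x y)) z"
    unfolding succ_op_def[of P "sup _ _" z] P_star
    by (simp add: succ_op_def inf_assoc)
qed

end
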